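(* Let $R$ be a finite commutative ring with identity, of order $n$, and let $k\ge 2$ be an integer. Then: (1) $$zp_k(R)\ \ge\ \frac{n^{k-1}+(n-|Z(R)|)\,|Ann_{k-1}(R)|}{n^k},$$ and equality holds if and only if $R$ is a field. (2) $$zp_k(R)\ \le\ \frac{n^{k-1}+(n-|Z(R)|)\,|Ann_{k-1}(R)|+(|Z(R)|-1)\left\{n^{k-1}-(n-|Z(R)|)^{k-1}\right\}}{n^k},$$ and equality holds if and only if $Z(R)^2=0$.
   Context: All rings are nonzero finite commutative rings with identity. For an integer $k\ge 1$, $Ann_k(R)=\{(x_1,\dots,x_k)\in R^k : x_1x_2\cdots x_k=0\}$ (so $Ann_1(R)=\{0\}$), and for $k\ge 2$, $zp_k(R)=|Ann_k(R)|/|R|^k$. $Z(R)$ is the set of all zero divisors of $R$, including $0$. $Z(R)^2=0$ means that $xy=0$ for all $x,y\in Z(R)$. *)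

theory Defs
  imports Complex_Main "HOL-Library.FuncSet" "HOL-Algebra.Ring"
begin

(* k-tuples over R are the extensional functions {1..k} \<rightarrow> carrier R, so that there are
   exactly order(R)^k of them. *)
definition Ann :: "('a, 'm) ring_scheme \<Rightarrow> nat \<Rightarrow> (nat \<Rightarrow> 'a) set" where
  "Ann R k = {x \<in> {1..k} \<rightarrow>\<^sub>E carrier R. finprod R x {1..k} = \<zero>\<^bsub>R\<^esub>}"

definition zp :: "('a, 'm) ring_scheme \<Rightarrow> nat \<Rightarrow> real" where
  "zp R k = real (card (Ann R k)) / real (card (carrier R)) ^ k"

(* 0 is a member whenever R is nonzero (take b = 1). *)
definition zero_divisors :: "('a, 'm) ring_scheme \<Rightarrow> 'a set" where
  "zero_divisors R = {a \<in> carrier R. \<exists>b \<in> carrier R. b \<noteq> \<zero>\<^bsub>R\<^esub> \<and> a \<otimes>\<^bsub>R\<^esub> b = \<zero>\<^bsub>R\<^esub>}"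

definition zero_divisors_sq_zero :: "('a, 'm) ring_scheme \<Rightarrow> bool" where
  "zero_divisors_sq_zero R \<longleftrightarrow>
     (\<forall>x \<in> zero_divisors R. \<forall>y \<in> zero_divisors R. x \<otimes>\<^bsub>R\<^esub> y = \<zero>\<^bsub>R\<^esub>)"

end

theory Submission
  imports Defs
begin

text \<open>
  Write \<open>k = m + 1\<close> and sort the \<open>k\<close>-tuples with product zero by their last entry \<open>a\<close>: the
  remaining \<open>m\<close> entries form a tuple whose product is killed by \<open>a\<close>, that is, an element of
  \<open>ann_fibre R m a\<close>. For \<open>a = 0\<close> all \<open>n\<^sup>m\<close> tuples qualify, and for \<open>a\<close> outside the set \<open>Z\<close> of zero
  divisors, where \<open>a\<close> can be cancelled, exactly those in \<open>Ann R m\<close>. These two contributions make up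
  the numerator of the lower bound, so both bounds are statements about the remaining sum over the
  nonzero zero divisors (lemma \<open>card_Ann_Suc\<close>).

  As \<open>m \<ge> 1\<close>, each summand is at least one, because the zero tuple qualifies. Hence the
  lower bound is attained exactly if there are no nonzero zero divisors, which for a finite ring
  means being a field.

  For the upper bound, a product of non-zero-divisors is a non-zero-divisor and is not killed by
  \<open>a \<noteq> 0\<close>. So every fibre lies in the set of tuples with at least one entry in \<open>Z\<close>, of size
  \<open>n\<^sup>m - (n - |Z|)\<^sup>m\<close>. The upper bound is attained exactly if every one of these fibres is that whole
  set. If \<open>Z\<^sup>2 = 0\<close> this is so, since a tuple with an entry in \<open>Z\<close> has its product in \<open>Z\<close>; conversely,
  testing the equality on the tuples \<open>(b, 1, \<dots>, 1)\<close> with \<open>b \<in> Z\<close> gives \<open>a b = 0\<close>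
  (lemma \<open>fibres_full_iff\<close>).
\<close>

text \<open>The fibre over \<open>a\<close> of the projection of \<open>Ann R (Suc m)\<close> to the last coordinate, with that
  coordinate dropped from the tuples.\<close>

definition ann_fibre :: "('a, 'm) ring_scheme \<Rightarrow> nat \<Rightarrow> 'a \<Rightarrow> (nat \<Rightarrow> 'a) set" where
  "ann_fibre R m a = {y \<in> {1..m} \<rightarrow>\<^sub>E carrier R. a \<otimes>\<^bsub>R\<^esub> finprod R y {1..m} = \<zero>\<^bsub>R\<^esub>}"

definition tuples_meeting_zero_divisors :: "('a, 'm) ring_scheme \<Rightarrow> nat \<Rightarrow> (nat \<Rightarrow> 'a) set" where
  "tuples_meeting_zero_divisors R m =
     ({1..m} \<rightarrow>\<^sub>E carrier R) - ({1..m} \<rightarrow>\<^sub>E carrier R - zero_divisors R)"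

context cring
begin

section \<open>Zero divisors and products\<close>

lemma zero_divisors_subset: "zero_divisors R \<subseteq> carrier R"
  by (auto simp: zero_divisors_def)

lemma zero_in_zero_divisors: "\<one> \<noteq> \<zero> \<Longrightarrow> \<zero> \<in> zero_divisors R"
  by (auto simp: zero_divisors_def intro!: bexI[of _ \<one>])

lemma zero_divisors_absorb:
  assumes "a \<in> zero_divisors R" "r \<in> carrier R"
  shows "a \<otimes> r \<in> zero_divisors R"
proof -
  obtain b where b: "a \<in> carrier R" "b \<in> carrier R" "b \<noteq> \<zero>" "a \<otimes> b = \<zero>"
    using assms(1) by (auto simp: zero_divisors_def)
  have "a \<otimes> r \<otimes> b = a \<otimes> b \<otimes> r"
    using b(1,2) assms(2) by (simp add: m_ac)
  then have "a \<otimes> r \<otimes> b = \<zero>"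
    using b(4) assms(2) by simp
  with b(1-3) assms(2) show ?thesis
    by (auto simp: zero_divisors_def)
qed

lemma non_zero_divisor_cancel:
  assumes "a \<in> carrier R - zero_divisors R" "x \<in> carrier R"
  shows "a \<otimes> x = \<zero> \<longleftrightarrow> x = \<zero>"
  using assms by (auto simp: zero_divisors_def)

lemma finprod_non_zero_divisors:
  assumes "\<one> \<noteq> \<zero>" "finite I" "y \<in> I \<rightarrow> carrier R - zero_divisors R"
  shows "finprod R y I \<in> carrier R - zero_divisors R"
  using assms(2,3)
proof (induction I rule: finite_induct)
  case empty
  show ?case using assms(1) by (auto simp: zero_divisors_def)
next
  case (insert i I)
  let ?p = "finprod R y I"
  have y: "y i \<in> carrier R - zero_divisors R" "y \<in> I \<rightarrow> carrier R"
    using insert.prems by auto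
  have p: "?p \<in> carrier R - zero_divisors R"
    using insert by auto
  have "y i \<otimes> ?p \<otimes> b \<noteq> \<zero>" if "b \<in> carrier R" "b \<noteq> \<zero>" for b
    using that y(1) p by (simp add: m_assoc non_zero_divisor_cancel)
  then show ?case
    using insert.hyps y p by (auto simp: zero_divisors_def)
qed

lemma finprod_zero_divisor:
  assumes "finite I" "y \<in> I \<rightarrow> carrier R" "i \<in> I" "y i \<in> zero_divisors R"
  shows "finprod R y I \<in> zero_divisors R"
proof -
  have "finprod R y (insert i (I - {i})) = y i \<otimes> finprod R y (I - {i})"
    using assms by (intro finprod_insert) auto
  moreover have "insert i (I - {i}) = I" using assms(3) by auto
  moreover have "finprod R y (I - {i}) \<in> carrier R"
    using assms(2) by (intro finprod_closed) auto
  ultimately show ?thesis using zero_divisors_absorb[OF assms(4)] by simp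
qed

section \<open>Counting by the last coordinate\<close>

lemma finprod_tuple_closed: "y \<in> {1..m} \<rightarrow>\<^sub>E carrier R \<Longrightarrow> finprod R y {1..m} \<in> carrier R"
  by (intro finprod_closed) auto

lemma finite_ann_fibre: "finite (carrier R) \<Longrightarrow> finite (ann_fibre R m a)"
  by (rule finite_subset[of _ "{1..m} \<rightarrow>\<^sub>E carrier R"])
     (auto simp: ann_fibre_def intro!: finite_PiE)

lemma ann_fibre_zero: "ann_fibre R m \<zero> = {1..m} \<rightarrow>\<^sub>E carrier R"
  by (auto simp: ann_fibre_def simp del: One_nat_def intro!: l_null finprod_tuple_closed)

lemma ann_fibre_non_zero_divisor:
  assumes "a \<in> carrier R - zero_divisors R"
  shows "ann_fibre R m a = Ann R m"
  using non_zero_divisor_cancel[OF assms] finprod_tuple_closed[of _ m]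
  by (auto simp: ann_fibre_def Ann_def simp del: One_nat_def)

lemma card_Ann_eq_sum:
  assumes "finite (carrier R)"
  shows "card (Ann R (Suc m)) = (\<Sum>a\<in>carrier R. card (ann_fibre R m a))"
proof -
  let ?f = "\<lambda>(a, y). y(Suc m := a)"
  have prod: "finprod R (y(Suc m := a)) {1..Suc m} = a \<otimes> finprod R y {1..m}"
    if "a \<in> carrier R" "y \<in> {1..m} \<rightarrow>\<^sub>E carrier R" for a y
  proof -
    have "finprod R (y(Suc m := a)) (insert (Suc m) {1..m})
        = (y(Suc m := a)) (Suc m) \<otimes> finprod R (y(Suc m := a)) {1..m}"
      using that by (intro finprod_insert) auto
    also have "finprod R (y(Suc m := a)) {1..m} = finprod R y {1..m}"
      using that by (intro finprod_cong') auto
    finally show ?thesis by (simp add: atLeastAtMostSuc_conv del: fun_upd_apply) simp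
  qed
  have tuples: "{1..Suc m} \<rightarrow>\<^sub>E carrier R = ?f ` (carrier R \<times> ({1..m} \<rightarrow>\<^sub>E carrier R))"
    by (simp add: atLeastAtMostSuc_conv PiE_insert_eq)
  have "Ann R (Suc m) = ?f ` (SIGMA a:carrier R. ann_fibre R m a)"
    unfolding Ann_def tuples using prod by (fastforce simp: ann_fibre_def)
  moreover have "inj_on ?f (carrier R \<times> ({1..m} \<rightarrow>\<^sub>E carrier R))"
    by (rule inj_combinator) simp
  then have "inj_on ?f (SIGMA a:carrier R. ann_fibre R m a)"
    by (rule inj_on_subset) (auto simp: ann_fibre_def)
  ultimately show ?thesis
    using assms by (simp add: card_image card_SigmaI finite_ann_fibre)
qed

text \<open>The first two summands are the fibres over zero and over the non-zero-divisors. They occur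
  unchanged in both bounds, so only the last sum has to be estimated.\<close>

lemma card_Ann_Suc:
  assumes "finite (carrier R)" "\<one> \<noteq> \<zero>"
  shows "card (Ann R (Suc m)) = card (carrier R) ^ m
       + (card (carrier R) - card (zero_divisors R)) * card (Ann R m)
       + (\<Sum>a\<in>zero_divisors R - {\<zero>}. card (ann_fibre R m a))"
proof -
  let ?Z = "zero_divisors R" and ?c = "\<lambda>a. card (ann_fibre R m a)"
  have fin: "finite ?Z"
    using assms(1) zero_divisors_subset by (rule finite_subset[rotated])
  have "sum ?c (carrier R) = sum ?c (carrier R - ?Z) + sum ?c ?Z"
    by (rule sum.subset_diff[OF zero_divisors_subset assms(1)])
  also have "sum ?c ?Z = ?c \<zero> + sum ?c (?Z - {\<zero>})"
    using fin zero_in_zero_divisors[OF assms(2)] by (rule sum.remove)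
  also have "?c \<zero> = card (carrier R) ^ m"
    by (simp add: ann_fibre_zero card_PiE)
  also have "sum ?c (carrier R - ?Z) = (card (carrier R) - card ?Z) * card (Ann R m)"
    using fin zero_divisors_subset by (simp add: ann_fibre_non_zero_divisor card_Diff_subset)
  finally show ?thesis
    using card_Ann_eq_sum[OF assms(1)] by simp
qed

section \<open>The lower bound\<close>

lemma card_ann_fibre_pos:
  assumes "finite (carrier R)" "a \<in> carrier R" "m \<ge> 1"
  shows "card (ann_fibre R m a) > 0"
proof -
  let ?y = "\<lambda>i\<in>{1..m}. \<zero>"
  have "finprod R ?y (insert 1 ({1..m} - {1})) = ?y 1 \<otimes> finprod R ?y ({1..m} - {1})"
    using assms(3) by (intro finprod_insert) auto
  moreover have "insert 1 ({1..m} - {1}) = {1..m}" using assms(3) by auto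
  moreover have "finprod R ?y ({1..m} - {1}) \<in> carrier R"
    by (intro finprod_closed) auto
  ultimately have "finprod R ?y {1..m} = \<zero>"
    using assms(3) by simp
  then have "?y \<in> ann_fibre R m a"
    using assms(2) by (auto simp: ann_fibre_def)
  then show ?thesis
    using finite_ann_fibre[OF assms(1)] by (auto simp: card_gt_0_iff)
qed

lemma field_iff_zero_divisors_trivial:
  assumes "finite (carrier R)" "\<one> \<noteq> \<zero>"
  shows "field R \<longleftrightarrow> zero_divisors R - {\<zero>} = {}"
proof
  assume "field R"
  then interpret field R .
  show "zero_divisors R - {\<zero>} = {}"
    by (auto simp: zero_divisors_def integral_iff)
next
  assume triv: "zero_divisors R - {\<zero>} = {}"
  show "field R"
  proof (rule cring_fieldI2)
    show "\<zero> \<noteq> \<one>" using assms(2) by simp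
    fix a assume a: "a \<in> carrier R" "a \<noteq> \<zero>"
    then have nzd: "a \<in> carrier R - zero_divisors R" using triv by auto
    \<comment> \<open>Multiplication by \<open>a\<close> is injective, hence by finiteness hits \<open>\<one>\<close>.\<close>
    have "inj_on ((\<otimes>) a) (carrier R)"
    proof (rule inj_onI)
      fix x y assume xy: "x \<in> carrier R" "y \<in> carrier R" "a \<otimes> x = a \<otimes> y"
      then have "a \<otimes> (x \<ominus> y) = \<zero>"
        using a(1) by (simp add: a_minus_def r_distr r_minus r_neg)
      then have "x \<ominus> y = \<zero>"
        using non_zero_divisor_cancel[OF nzd] xy by simp
      then show "x = y"
        using xy(1,2) by (metis a_inv_closed a_minus_def minus_equality minus_minus)
    qed
    then have "(\<otimes>) a ` carrier R = carrier R"
      using assms(1) a(1) by (intro endo_inj_surj) auto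
    then show "\<exists>b\<in>carrier R. a \<otimes> b = \<one>"
      using one_closed by (metis imageE)
  qed
qed

section \<open>The upper bound\<close>

text \<open>If all entries were non-zero-divisors, their product could be cancelled, leaving \<open>a = \<zero>\<close>.\<close>

lemma ann_fibre_subset:
  assumes "\<one> \<noteq> \<zero>" "a \<in> carrier R" "a \<noteq> \<zero>"
  shows "ann_fibre R m a \<subseteq> tuples_meeting_zero_divisors R m"
proof
  fix y assume y: "y \<in> ann_fibre R m a"
  then have yR: "y \<in> {1..m} \<rightarrow>\<^sub>E carrier R" and 0: "a \<otimes> finprod R y {1..m} = \<zero>"
    by (auto simp: ann_fibre_def)
  have "y \<notin> {1..m} \<rightarrow>\<^sub>E carrier R - zero_divisors R"
  proof
    assume "y \<in> {1..m} \<rightarrow>\<^sub>E carrier R - zero_divisors R"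
    then have p: "finprod R y {1..m} \<in> carrier R - zero_divisors R"
      using assms(1) by (intro finprod_non_zero_divisors) auto
    then have "finprod R y {1..m} \<otimes> a = \<zero>"
      using 0 assms(2) by (simp add: m_comm)
    with non_zero_divisor_cancel[OF p assms(2)] assms(3) show False by simp
  qed
  with yR show "y \<in> tuples_meeting_zero_divisors R m"
    by (simp add: tuples_meeting_zero_divisors_def)
qed

lemma finite_tuples_meeting_zero_divisors:
  "finite (carrier R) \<Longrightarrow> finite (tuples_meeting_zero_divisors R m)"
  by (auto simp: tuples_meeting_zero_divisors_def intro!: finite_Diff finite_PiE)

lemma card_tuples_meeting_zero_divisors:
  assumes "finite (carrier R)"
  shows "real (card (tuples_meeting_zero_divisors R m)) = real (card (carrier R)) ^ m
       - (real (card (carrier R)) - real (card (zero_divisors R))) ^ m"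
proof -
  have fin: "finite (zero_divisors R)"
    using assms zero_divisors_subset by (rule finite_subset[rotated])
  have sub: "({1..m} \<rightarrow>\<^sub>E carrier R - zero_divisors R) \<subseteq> ({1..m} \<rightarrow>\<^sub>E carrier R)"
    by (intro PiE_mono) auto
  have finP: "finite ({1..m} \<rightarrow>\<^sub>E carrier R)"
    using assms by (intro finite_PiE) auto
  have le: "card (zero_divisors R) \<le> card (carrier R)"
    using assms zero_divisors_subset by (rule card_mono)
  have "real (card (tuples_meeting_zero_divisors R m))
      = real (card ({1..m} \<rightarrow>\<^sub>E carrier R)) - real (card ({1..m} \<rightarrow>\<^sub>E carrier R - zero_divisors R))"
    unfolding tuples_meeting_zero_divisors_def
    using sub finP by (subst card_Diff_subset) (auto simp: of_nat_diff card_mono intro: finite_subset)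
  also have "\<dots> = real (card (carrier R)) ^ m - real (card (carrier R) - card (zero_divisors R)) ^ m"
    using fin zero_divisors_subset by (simp add: card_PiE card_Diff_subset)
  finally show ?thesis using le by (simp add: of_nat_diff)
qed

text \<open>The zero divisors absorb multiplication, so the product of a tuple meeting them is again a zero
  divisor, and squaring to zero makes every fibre over a nonzero zero divisor full.
  Conversely, padding a zero divisor \<open>b\<close> with ones gives a tuple whose membership in the fibre
  over \<open>a\<close> says just \<open>a \<otimes> b = \<zero>\<close>.\<close>

lemma fibres_full_iff:
  assumes "\<one> \<noteq> \<zero>" "m \<ge> 1"
  shows "(\<forall>a\<in>zero_divisors R - {\<zero>}. ann_fibre R m a = tuples_meeting_zero_divisors R m)
     \<longleftrightarrow> zero_divisors_sq_zero R"
proof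
  assume full: "\<forall>a\<in>zero_divisors R - {\<zero>}. ann_fibre R m a = tuples_meeting_zero_divisors R m"
  have "a \<otimes> b = \<zero>" if a: "a \<in> zero_divisors R" and b: "b \<in> zero_divisors R" for a b
  proof (cases "a = \<zero>")
    case True
    with b zero_divisors_subset show ?thesis by auto
  next
    case False
    let ?y = "\<lambda>i\<in>{1..m}. if i = 1 then b else \<one>"
    have bR: "b \<in> carrier R" using b zero_divisors_subset by auto
    have y1: "?y 1 = b" using assms(2) by simp
    have "?y \<in> {1..m} \<rightarrow>\<^sub>E carrier R" using bR by auto
    moreover have "?y \<notin> {1..m} \<rightarrow>\<^sub>E carrier R - zero_divisors R"
    proof
      assume "?y \<in> {1..m} \<rightarrow>\<^sub>E carrier R - zero_divisors R"
      then have "?y 1 \<in> carrier R - zero_divisors R"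
        by (rule PiE_mem) (use assms(2) in simp)
      with y1 b show False by simp
    qed
    ultimately have "?y \<in> ann_fibre R m a"
      using full a False by (auto simp: tuples_meeting_zero_divisors_def)
    then have 0: "a \<otimes> finprod R ?y {1..m} = \<zero>"
      by (simp add: ann_fibre_def)
    have "finprod R ?y (insert 1 ({1..m} - {1})) = ?y 1 \<otimes> finprod R ?y ({1..m} - {1})"
      using bR assms(2) by (intro finprod_insert) auto
    moreover have "finprod R ?y ({1..m} - {1}) = \<one>"
      by (rule finprod_one_eqI) auto
    moreover have "insert 1 ({1..m} - {1}) = {1..m}" using assms(2) by auto
    ultimately have "finprod R ?y {1..m} = b"
      using bR y1 by simp
    with 0 show ?thesis by simp
  qed
  then show "zero_divisors_sq_zero R" by (simp add: zero_divisors_sq_zero_def)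
next
  assume sq: "zero_divisors_sq_zero R"
  show "\<forall>a\<in>zero_divisors R - {\<zero>}. ann_fibre R m a = tuples_meeting_zero_divisors R m"
  proof (intro ballI equalityI)
    fix a assume a: "a \<in> zero_divisors R - {\<zero>}"
    then show "ann_fibre R m a \<subseteq> tuples_meeting_zero_divisors R m"
      using assms(1) zero_divisors_subset by (intro ann_fibre_subset) auto
    show "tuples_meeting_zero_divisors R m \<subseteq> ann_fibre R m a"
    proof
      fix y assume "y \<in> tuples_meeting_zero_divisors R m"
      then have yR: "y \<in> {1..m} \<rightarrow>\<^sub>E carrier R" and "\<exists>i\<in>{1..m}. y i \<in> zero_divisors R"
        by (auto simp: tuples_meeting_zero_divisors_def PiE_iff)
      then have "finprod R y {1..m} \<in> zero_divisors R"
        using finprod_zero_divisor[of "{1..m}" y] by (auto simp: PiE_iff)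
      with a sq yR show "y \<in> ann_fibre R m a"
        by (simp add: ann_fibre_def zero_divisors_sq_zero_def)
    qed
  qed
qed

end

lemma sum_eq_card_mult_iff:
  fixes f :: "'b \<Rightarrow> nat"
  assumes "finite S" "\<And>a. a \<in> S \<Longrightarrow> f a \<le> B"
  shows "sum f S = card S * B \<longleftrightarrow> (\<forall>a\<in>S. f a = B)"
proof -
  have "(\<Sum>a\<in>S. f a) = (\<Sum>a\<in>S. B) \<longleftrightarrow> (\<forall>a\<in>S. f a = B)"
  proof
    assume "(\<Sum>a\<in>S. f a) = (\<Sum>a\<in>S. B)"
    then show "\<forall>a\<in>S. f a = B"
      using sum_mono_inv[of f S "\<lambda>_. B"] assms by auto
  qed simp
  then show ?thesis by simp
qed

section \<open>Bounds and equality cases\<close>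

theorem theorem2p5:
  fixes R :: "('a, 'm) ring_scheme" and n k :: nat
  assumes "cring R" and "finite (carrier R)" and "\<one>\<^bsub>R\<^esub> \<noteq> \<zero>\<^bsub>R\<^esub>"
    and "card (carrier R) = n" and "k \<ge> 2"
  shows "let z = real (card (zero_divisors R));
             A = real (card (Ann R (k - 1)));
             L = (real n ^ (k - 1) + (real n - z) * A) / real n ^ k;
             U = (real n ^ (k - 1) + (real n - z) * A
                   + (z - 1) * (real n ^ (k - 1) - (real n - z) ^ (k - 1))) / real n ^ k
         in (zp R k \<ge> L \<and> (zp R k = L \<longleftrightarrow> field R))
          \<and> (zp R k \<le> U \<and> (zp R k = U \<longleftrightarrow> zero_divisors_sq_zero R))"
proof -
  interpret cring R by (rule assms(1))
  obtain m where k: "k = Suc m" and m: "m \<ge> 1"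
    using assms(5) by (cases k) auto
  define z where "z = card (zero_divisors R)"
  define A where "A = card (Ann R m)"
  define S where "S = (\<Sum>a\<in>zero_divisors R - {\<zero>\<^bsub>R\<^esub>}. card (ann_fibre R m a))"
  define B where "B = card (tuples_meeting_zero_divisors R m)"
  have finZ: "finite (zero_divisors R)"
    using assms(2) zero_divisors_subset by (rule finite_subset[rotated])
  have zn: "z \<le> n"
    unfolding z_def assms(4)[symmetric] using assms(2) zero_divisors_subset by (rule card_mono)
  have "z \<ge> 1"
    using zero_in_zero_divisors[OF assms(3)] finZ
    by (auto simp: z_def Suc_le_eq card_gt_0_iff)
  then have z1: "real (card (zero_divisors R - {\<zero>\<^bsub>R\<^esub>})) = real z - 1"
    using zero_in_zero_divisors[OF assms(3)] finZ by (simp add: z_def)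
  have "n > 0"
    using assms(2,4) zero_closed by (auto simp: card_gt_0_iff simp del: zero_closed)
  have "card (Ann R k) = n ^ m + (n - z) * A + S"
    using card_Ann_Suc[OF assms(2,3)] by (simp add: k S_def A_def z_def assms(4))
  then have zp: "zp R k = (real n ^ m + (real n - real z) * real A + real S) / real n ^ k"
    using zn by (simp add: zp_def assms(4) of_nat_diff)
  have B: "real B = real n ^ m - (real n - real z) ^ m"
    using card_tuples_meeting_zero_divisors[OF assms(2)] by (simp add: B_def z_def assms(4))
  have "S = 0 \<longleftrightarrow> zero_divisors R - {\<zero>\<^bsub>R\<^esub>} = {}"
  proof -
    have "card (ann_fibre R m a) > 0" if "a \<in> zero_divisors R" for a
      using that zero_divisors_subset by (intro card_ann_fibre_pos assms(2) m) auto
    then have "\<forall>a\<in>zero_divisors R - {\<zero>\<^bsub>R\<^esub>}. card (ann_fibre R m a) \<noteq> 0"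
      by simp
    moreover have "S = 0 \<longleftrightarrow> (\<forall>a\<in>zero_divisors R - {\<zero>\<^bsub>R\<^esub>}. card (ann_fibre R m a) = 0)"
      unfolding S_def using finZ by (intro sum_eq_0_iff) auto
    ultimately show ?thesis by blast
  qed
  then have lower_eq: "S = 0 \<longleftrightarrow> field R"
    using field_iff_zero_divisors_trivial[OF assms(2,3)] by simp
  have fin: "finite (tuples_meeting_zero_divisors R m)"
    by (rule finite_tuples_meeting_zero_divisors[OF assms(2)])
  have sub: "ann_fibre R m a \<subseteq> tuples_meeting_zero_divisors R m"
    if "a \<in> zero_divisors R - {\<zero>\<^bsub>R\<^esub>}" for a
    using that zero_divisors_subset assms(3) by (intro ann_fibre_subset) auto
  have le: "card (ann_fibre R m a) \<le> B" if "a \<in> zero_divisors R - {\<zero>\<^bsub>R\<^esub>}" for a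
    unfolding B_def using fin sub[OF that] by (rule card_mono)
  have "S \<le> card (zero_divisors R - {\<zero>\<^bsub>R\<^esub>}) * B"
    unfolding S_def using sum_bounded_above[OF le, of "zero_divisors R - {\<zero>\<^bsub>R\<^esub>}" "\<lambda>a. a"] by simp
  then have "real S \<le> real (card (zero_divisors R - {\<zero>\<^bsub>R\<^esub>}) * B)"
    by (rule of_nat_mono)
  then have upper: "real S \<le> (real z - 1) * real B"
    by (simp only: of_nat_mult z1)
  have "S = card (zero_divisors R - {\<zero>\<^bsub>R\<^esub>}) * B
      \<longleftrightarrow> (\<forall>a\<in>zero_divisors R - {\<zero>\<^bsub>R\<^esub>}. card (ann_fibre R m a) = B)"
    unfolding S_def using finZ le by (intro sum_eq_card_mult_iff) auto
  also have "\<dots> \<longleftrightarrow> (\<forall>a\<in>zero_divisors R - {\<zero>\<^bsub>R\<^esub>}.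
                      ann_fibre R m a = tuples_meeting_zero_divisors R m)"
    unfolding B_def using card_subset_eq[OF fin sub] by metis
  also have "\<dots> \<longleftrightarrow> zero_divisors_sq_zero R"
    by (rule fibres_full_iff[OF assms(3) m])
  finally have "real S = real (card (zero_divisors R - {\<zero>\<^bsub>R\<^esub>}) * B) \<longleftrightarrow> zero_divisors_sq_zero R"
    by (simp only: of_nat_eq_iff)
  then have upper_eq: "real S = (real z - 1) * real B \<longleftrightarrow> zero_divisors_sq_zero R"
    by (simp only: of_nat_mult z1)
  have km: "k - 1 = m" by (simp add: k)
  show ?thesis
    unfolding Let_def km zp z_def[symmetric] A_def[symmetric] B[symmetric]
    using \<open>n > 0\<close> upper lower_eq upper_eq
    by (simp add: divide_le_cancel divide_cancel_right divide_right_mono)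
qed

end
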